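(* Let $G=(V,E)$ be a finite planar graph and let $U$ be the set of its faces. Then for all $\beta>0$ and all increasing functions $\Psi,\Phi:\mathbb N^U\to\mathbb R_+$, $$\mathbb E_{G,\beta}[\Psi(|h|)\Phi(|h|)]\ge\mathbb E_{G,\beta}[\Psi(|h|)]\,\mathbb E_{G,\beta}[\Phi(|h|)],$$ where $|h|=(|h(u)|)_{u\in U}$ is the absolute value of the dual height function of the XY model on $G$.
   Context: $\mathbb N=\{0,1,2,\dots\}$; "increasing" means nondecreasing with respect to the coordinatewise partial order. The dual height function of the XY model (coupling constants all equal to $1$) on a finite planar graph $G$ (with a fixed embedding) is the random function $h:U\to\mathbb Z$ with $h=0$ at the outer face and law $$\mathbb P_{G,\beta}(h)\propto\prod_{uu'\in E^\dagger}I_{|h(u)-h(u')|}(\beta),$$ where $E^\dagger$ is the set of dual edges (one dual edge $uu'$ for each edge of $G$, joining the two faces on its sides), and $I_k(\beta)=\sum_{i\ge0}\frac1{i!(i+k)!}(\beta/2)^{2i+k}$, $k\ge0$, is the modified Bessel function. $\mathbb E_{G,\beta}$ is the corresponding expectation. *)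

theory Defs
  imports "HOL-Probability.Probability"
begin

(* A finite graph together with a fixed embedding in the plane. Loops and multiple edges are
   allowed, and no connectedness is required; a simple graph is the case where ends is injective
   on the edges with two-element values. *)
record ('v, 'e) embedded_graph =
  verts :: "'v set"
  edges :: "'e set"
  ends  :: "'e \<Rightarrow> 'v set"
  pos   :: "'v \<Rightarrow> complex"
  curve :: "'e \<Rightarrow> real \<Rightarrow> complex"

definition plane_graph :: "('v, 'e) embedded_graph \<Rightarrow> bool" where
  "plane_graph G \<longleftrightarrow>
     finite (verts G) \<and> finite (edges G) \<and> inj_on (pos G) (verts G) \<and>
     (\<forall>e\<in>edges G. ends G e \<subseteq> verts G \<and> simple_path (curve G e) \<and>
        pos G ` ends G e = {pathstart (curve G e), pathfinish (curve G e)} \<and>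
        curve G e ` {0<..<1} \<inter> pos G ` verts G = {}) \<and>
     (\<forall>e\<in>edges G. \<forall>e'\<in>edges G. e \<noteq> e' \<longrightarrow>
        curve G e ` {0<..<1} \<inter> curve G e' ` {0<..<1} = {})"

definition drawing :: "('v, 'e) embedded_graph \<Rightarrow> complex set" where
  "drawing G = pos G ` verts G \<union> (\<Union>e\<in>edges G. path_image (curve G e))"

definition faces :: "('v, 'e) embedded_graph \<Rightarrow> complex set set" where
  "faces G = components (- drawing G)"

(* The drawing is compact, so its complement has exactly one unbounded component. *)
definition outer_face :: "('v, 'e) embedded_graph \<Rightarrow> complex set" where
  "outer_face G = outside (drawing G)"

definition side_faces :: "('v, 'e) embedded_graph \<Rightarrow> 'e \<Rightarrow> complex set set" where
  "side_faces G e = {u \<in> faces G. path_image (curve G e) \<subseteq> frontier u}"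

(* Endpoints of the dual edge of e, in an arbitrary order. In a plane graph an edge has one or two
   faces on its sides; if it has only one (a bridge), the dual edge is a loop. *)
definition dual_edge :: "('v, 'e) embedded_graph \<Rightarrow> 'e \<Rightarrow> complex set \<times> complex set" where
  "dual_edge G e = (SOME (u, u'). side_faces G e = {u, u'})"

definition bessel_I :: "nat \<Rightarrow> real \<Rightarrow> real" where
  "bessel_I k x = (\<Sum>i. 1 / (fact i * fact (i + k)) * (x / 2) ^ (2 * i + k))"

(* Functions on U are represented by functions on all sets of points that vanish outside U. *)
definition heights :: "('v, 'e) embedded_graph \<Rightarrow> (complex set \<Rightarrow> int) set" where
  "heights G = {h \<in> PiE_dflt (faces G) 0 (\<lambda>_. UNIV). h (outer_face G) = 0}"

definition abs_heights :: "('v, 'e) embedded_graph \<Rightarrow> (complex set \<Rightarrow> nat) set" where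
  "abs_heights G = PiE_dflt (faces G) 0 (\<lambda>_. UNIV)"

definition abs_height :: "(complex set \<Rightarrow> int) \<Rightarrow> complex set \<Rightarrow> nat" where
  "abs_height h = (\<lambda>u. nat \<bar>h u\<bar>)"

definition height_weight ::
  "('v, 'e) embedded_graph \<Rightarrow> real \<Rightarrow> (complex set \<Rightarrow> int) \<Rightarrow> real" where
  "height_weight G \<beta> h =
     (\<Prod>e\<in>edges G. case dual_edge G e of (u, u') \<Rightarrow> bessel_I (nat \<bar>h u - h u'\<bar>) \<beta>)"

definition partition_function :: "('v, 'e) embedded_graph \<Rightarrow> real \<Rightarrow> ennreal" where
  "partition_function G \<beta> = (\<integral>\<^sup>+ h. ennreal (height_weight G \<beta> h) \<partial>count_space (heights G))"

(* For beta > 0 the partition function is positive and finite, since the dual graph of a plane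
   graph is finite and connected and h is pinned at the outer face. *)
definition height_law ::
  "('v, 'e) embedded_graph \<Rightarrow> real \<Rightarrow> (complex set \<Rightarrow> int) measure" where
  "height_law G \<beta> = density (count_space (heights G))
     (\<lambda>h. ennreal (height_weight G \<beta> h) / partition_function G \<beta>)"

end

theory Submission
  imports Defs
begin

text \<open>Given the absolute values of the heights, their signs form a ferromagnetic Ising model whose
  couplings are increasing and supermodular functions of the absolute values; this holds because
  the curvature \<open>2 ln I_k - ln I_{k+1} - ln I_{k-1}\<close> of the logarithm of the Bessel function is
  nonnegative and decreasing in \<open>k \<ge> 0\<close>. The logarithm of the Ising partition function
  has nonnegative first and second derivatives in the couplings, by the inequalities of Griffiths
  and Ginibre, so the law of the absolute values satisfies the FKG lattice condition. The four
  functions theorem then gives positive association.\<close>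

section \<open>Curvature of the logarithm of the Bessel functions\<close>

text \<open>The delicate input is the decrease of the curvature, a quartic inequality between four
  consecutive Bessel functions. It is followed along the argument from 0, where it is elementary;
  the derivative has to be known only at a possible first equality, where the Bessel recurrence
  leaves a single free parameter and the sign becomes explicit. The two curvature conditions have
  separate roles. Mixed differences of the coupling are half the sum, and those of the
  sign-independent part of the log-weight half the difference, of two curvatures. So concavity
  serves the Ising factor, and the decrease serves the other factor. The derivative conditions on
  the Ising sum Z enter as finite increments: Z is increasing, and Z(j+x) Z(j+y) \<le> Z(j+x+y)
  Z(j). Sums over the infinite set of heights are taken in \<open>ennreal\<close>, so the lattice
  argument runs before normalisation.\<close>

definition bessel_series :: "nat \<Rightarrow> real \<Rightarrow> real" where
  "bessel_series k t = (\<Sum>i. 1 / (fact i * fact (i + k)) * t ^ i)"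

lemma summable_bessel_series:
  fixes t :: real
  shows "summable (\<lambda>i. 1 / (fact i * fact (i + k)) * t ^ i)"
proof (rule summable_comparison_test')
  show "summable (\<lambda>i. inverse (fact i) * \<bar>t\<bar> ^ i)"
    by (rule summable_exp)
  fix i :: nat
  have "1 \<le> (fact (i + k) :: real)"
    by (rule fact_ge_1)
  hence "fact i * 1 \<le> (fact i * fact (i + k) :: real)"
    by (intro mult_left_mono) auto
  hence "1 / (fact i * fact (i + k)) \<le> (inverse (fact i) :: real)"
    by (simp add: divide_simps)
  from mult_right_mono[OF this, of "\<bar>t\<bar> ^ i"] show "norm (1 / (fact i * fact (i + k)) * t ^ i) \<le> inverse (fact i) * \<bar>t\<bar> ^ i"
    by (simp add: abs_mult power_abs)
qed

lemma bessel_series_pos: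
  assumes "t \<ge> 0" shows "bessel_series k t > 0"
  unfolding bessel_series_def
  by (rule suminf_pos2[OF summable_bessel_series, where i = 0]) (use assms in auto)

lemma bessel_series_0: "bessel_series k 0 = 1 / fact k"
  unfolding bessel_series_def by (subst suminf_finite[where N = "{0}"]) auto

text \<open>Write the coefficient 1/(i! (i+k)!) as (k+1+i)/(i! (i+k+1)!): the part k+1 gives the
  first term, and the part i cancels against i! and shifts the sum by one.\<close>

lemma bessel_series_rec:
  "bessel_series k t = (real k + 1) * bessel_series (k + 1) t + t * bessel_series (k + 2) t"
proof -
  define a where "a k i = 1 / (fact i * fact (i + k)) * t ^ i" for k i
  have a: "a k sums bessel_series k t" for k
    unfolding a_def bessel_series_def by (rule summable_sums[OF summable_bessel_series])
  have shift: "t * a (k + 2) i = real (Suc i) * a (k + 1) (Suc i)" for i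
    unfolding a_def by (simp add: divide_simps)
  have "(\<lambda>i. real i * a (k + 1) i) sums (t * bessel_series (k + 2) t)"
    using sums_mult[OF a[of "k + 2"], of t] sums_Suc_iff[of "\<lambda>i. real i * a (k + 1) i"]
    unfolding shift by simp
  from sums_add[OF sums_mult[OF a[of "k + 1"], of "real k + 1"] this]
  have "(\<lambda>i. (real k + 1) * a (k + 1) i + real i * a (k + 1) i) sums
      ((real k + 1) * bessel_series (k + 1) t + t * bessel_series (k + 2) t)" .
  also have "(\<lambda>i. (real k + 1) * a (k + 1) i + real i * a (k + 1) i) = a k"
    unfolding a_def by (intro ext) (simp add: divide_simps, simp add: algebra_simps)
  finally show ?thesis
    using a[of k] by (rule sums_unique2[rotated])
qed

text \<open>Dropping the power (x/2)^k and using t = (x/2)^2 makes differentiation a pure index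
  shift and keeps the series positive at t = 0, where the comparison argument starts.\<close>

lemma bessel_series_deriv:
  "(bessel_series k has_real_derivative bessel_series (Suc k) t) (at t)"
proof -
  have "diffs (\<lambda>i. 1 / (fact i * fact (i + k))) =
      (\<lambda>i. 1 / (fact i * fact (i + Suc k)) :: real)"
    by (intro ext) (simp add: diffs_def divide_simps)
  with termdiffs_strong_converges_everywhere[OF summable_bessel_series, of k t]
  show ?thesis
    unfolding bessel_series_def[abs_def] by simp
qed

lemma bessel_I_eq: "bessel_I k x = (x / 2) ^ k * bessel_series k ((x / 2)\<^sup>2)"
  unfolding bessel_I_def bessel_series_def
  unfolding suminf_mult[OF summable_bessel_series, symmetric]
  by (intro suminf_cong) (simp only: power_add power_mult[symmetric] mult_ac)

lemma bessel_I_pos: "x > 0 \<Longrightarrow> bessel_I k x > 0"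
  by (simp add: bessel_I_eq bessel_series_pos)

text \<open>Let u be the first point where f is not positive. Continuity gives f u = 0, and a
  positive derivative there would make f negative just before u. The sign of the derivative thus
  matters only at zeros of f, where an extra equation is available.\<close>

lemma positive_barrier:
  fixes f f' :: "real \<Rightarrow> real"
  assumes deriv: "\<And>t. t \<ge> 0 \<Longrightarrow> (f has_real_derivative f' t) (at t)"
    and zero: "f 0 > 0"
    and increasing: "\<And>t. t > 0 \<Longrightarrow> f t = 0 \<Longrightarrow> f' t > 0"
    and "t \<ge> 0"
  shows "f t > 0"
proof (rule ccontr)
  assume "\<not> f t > 0"
  define S where "S = {0..t} \<inter> f -` {..0}"
  have "continuous_on {0..t} f"
    by (intro continuous_at_imp_continuous_on ballI) (use deriv DERIV_isCont in auto)
  hence "closed S"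
    unfolding S_def by (intro continuous_closed_preimage) auto
  moreover have "bdd_below S" "t \<in> S"
    using \<open>t \<ge> 0\<close> \<open>\<not> f t > 0\<close> by (auto simp: S_def)
  moreover define u where "u = Inf S"
  ultimately have "u \<in> S"
    using closed_contains_Inf[of S] by auto
  have below: "f v > 0" if "0 \<le> v" "v < u" for v
  proof (rule ccontr)
    assume "\<not> f v > 0"
    hence "v \<in> S"
      using that \<open>u \<in> S\<close> by (auto simp: S_def)
    thus False
      using cInf_lower[OF _ \<open>bdd_below S\<close>, of v] that by (simp add: u_def)
  qed
  have "u > 0" "f u \<le> 0"
    using \<open>u \<in> S\<close> zero by (auto simp: S_def less_le)
  have "((\<lambda>v. f v) \<longlongrightarrow> f u) (at_left u)"
    using DERIV_isCont[OF deriv[of u]] \<open>u > 0\<close>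
    by (auto simp: isCont_def intro: filterlim_at_split[THEN iffD1, THEN conjunct1])
  moreover have "\<forall>\<^sub>F v in at_left u. f v \<ge> 0"
    using eventually_at_left_real[OF \<open>u > 0\<close>]
    by eventually_elim (auto intro: less_imp_le below)
  ultimately have "f u \<ge> 0"
    by (rule tendsto_lowerbound) simp
  with \<open>f u \<le> 0\<close> have "f u = 0"
    by simp
  from DERIV_pos_inc_left[OF deriv[of u] increasing[OF \<open>u > 0\<close> this]] \<open>u > 0\<close>
  obtain d where d: "d > 0" "\<And>h. 0 < h \<Longrightarrow> h < d \<Longrightarrow> f (u - h) < f u"
    by auto
  define h where "h = min d u / 2"
  have "f (u - h) < 0"
    using d \<open>u > 0\<close> \<open>f u = 0\<close> by (auto simp: h_def)
  moreover have "f (u - h) > 0"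
    using d \<open>u > 0\<close> by (intro below) (auto simp: h_def)
  ultimately show False
    by simp
qed

text \<open>For \<open>I_k = (x / 2) ^ k * bessel_series k t\<close> with \<open>t = x\<^sup>2 / 4\<close>, this says
  \<open>I_{k+1}\<^sup>3 * I_{k-1} < I_k\<^sup>3 * I_{k+2}\<close>, where \<open>I_{-1} = I_1\<close>.\<close>

lemma bessel_series_ratio_bound:
  fixes k :: nat
  assumes "t \<ge> 0"
  defines "q \<equiv> bessel_series (k + 1) t / bessel_series k t"
  shows "real k * q ^ 3 + t * q ^ 4 < bessel_series (k + 2) t / bessel_series k t"
proof -
  define f where "f i = bessel_series (k + i)" for i
  have f_pos: "f i t > 0" if "t \<ge> 0" for i t
    using that by (simp add: f_def bessel_series_pos)
  have f_deriv: "(f i has_real_derivative f (Suc i) t) (at t)" for i t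
    using bessel_series_deriv[of "k + i" t] by (simp add: f_def)
  define Q where "Q t = f 1 t / f 0 t" for t
  define R where "R t = f 2 t / f 0 t" for t
  define D where "D t = R t - (real k * Q t ^ 3 + t * Q t ^ 4)" for t
  define Q' where "Q' t = R t - Q t ^ 2" for t
  define D' where "D' t = f 3 t / f 0 t - R t * Q t
      - (3 * real k * Q t ^ 2 * Q' t + Q t ^ 4 + t * (4 * Q t ^ 3 * Q' t))" for t
  have Q_deriv: "(Q has_real_derivative Q' t) (at t)" if "t \<ge> 0" for t
    unfolding Q_def[abs_def] Q'_def R_def using f_pos[OF that, of 0]
    by (auto intro!: derivative_eq_intros f_deriv simp: eval_nat_numeral field_simps)
  have R_deriv: "(R has_real_derivative (f 3 t / f 0 t - R t * Q t)) (at t)" if "t \<ge> 0" for t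
    unfolding R_def[abs_def] Q_def using f_pos[OF that, of 0]
    by (auto intro!: derivative_eq_intros f_deriv simp: eval_nat_numeral field_simps)
  have "D t > 0"
  proof (rule positive_barrier[where f = D and f' = D' and t = t])
    fix t :: real assume "t \<ge> 0"
    show "(D has_real_derivative D' t) (at t)"
      unfolding D_def[abs_def] D'_def
      by (auto intro!: derivative_eq_intros Q_deriv R_deriv \<open>t \<ge> 0\<close>)
  next
    \<comment> \<open>At t = 0 the claim reduces to (c-1)(c+1) < c^2.\<close>
    define c where "c = real k + 1"
    have "c > 0"
      by (simp add: c_def)
    have "fact (k + 1) = c * fact k" "fact (k + 2) = c * (c + 1) * fact k"
      by (simp_all add: c_def algebra_simps)
    hence "Q 0 = 1 / c" "R 0 = 1 / (c * (c + 1))"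
      by (simp_all add: Q_def R_def f_def bessel_series_0 del: fact_Suc)
    moreover have "(c - 1) / c ^ 3 < 1 / (c * (c + 1))"
      using \<open>c > 0\<close> by (simp add: divide_simps power3_eq_cube) (simp add: algebra_simps)
    ultimately show "D 0 > 0"
      by (simp add: D_def power_divide c_def)
  next
    fix t :: real assume t: "t > 0" "D t = 0"
    define q where "q = Q t"
    \<comment> \<open>In terms of Bessel functions m is (I_{k+1}/I_k)^2. Both q and
      \<open>R t\<close> become expressions in k and m at a zero of \<open>D\<close>.\<close>
    define m where "m = t * q ^ 2"
    define A where "A = real k + 1 + real k * m"
    have "q > 0"
      using f_pos[of t] t by (simp add: q_def Q_def)
    hence "m > 0" "A > 0"
      using t by (simp_all add: m_def A_def add_pos_nonneg)
    have s: "R t = q ^ 2 * (real k * q + m)"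
      using t by (simp add: D_def m_def q_def power_numeral_reduce algebra_simps)
    have "t * R t = 1 - (real k + 1) * q"
      using bessel_series_rec[of k t] f_pos[of t 0] t
      by (simp add: q_def R_def Q_def f_def field_simps)
    with s have ts: "m * (real k * q + m) = 1 - (real k + 1) * q"
      by (simp add: m_def)
    hence qA: "q * A = 1 - m ^ 2"
      by (simp add: A_def algebra_simps power2_eq_square)
    have "m < 1"
    proof (rule ccontr)
      assume "\<not> m < 1"
      hence "1 \<le> m ^ 2"
        by simp
      moreover have "q * A > 0"
        using \<open>q > 0\<close> \<open>A > 0\<close> by simp
      ultimately show False
        using qA by simp
    qed
    \<comment> \<open>The equation \<open>D t = 0\<close> turns the Bessel recurrence into \<open>q * A = 1 - m\<^sup>2\<close>, which makes
      \<open>t * D' t\<close> equal to \<open>q * (1 - m) ^ 3 / A\<^sup>2\<close>.\<close>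
    define X where "X = 1 - (real k + 2) * q * (real k * q + m) - m * (real k * q + m)
        - (3 * real k * q + 4 * m) * m * (real k * q + m - 1) - m * q"
    \<comment> \<open>The recurrence eliminates \<open>f 3\<close> only when it is multiplied by t,
      which is why the sign of \<open>t * D' t\<close> is computed.\<close>
    have tw: "t * (f 3 t / f 0 t) = q - (real k + 2) * R t"
      using bessel_series_rec[of "k + 1" t] f_pos[of t 0] t
      by (simp add: q_def R_def Q_def f_def field_simps eval_nat_numeral)
    have "t * D' t = t * (f 3 t / f 0 t) - t * R t * q
        - (3 * real k * q ^ 2 + 4 * t * q ^ 3) * (t * R t - t * q ^ 2) - t * q ^ 4"
      by (simp add: D'_def Q'_def q_def algebra_simps)
    also have "\<dots> = q * X"
      unfolding tw s X_def m_def by algebra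
    finally have "t * D' t = q * X" .
    moreover have "X * A ^ 2 = (1 - m) ^ 3"
      using qA unfolding X_def A_def by algebra
    hence "X > 0"
      using \<open>m < 1\<close> \<open>A > 0\<close> by (smt (verit) zero_less_mult_pos2 zero_less_power)
    ultimately have "t * D' t > 0"
      using \<open>q > 0\<close> by simp
    thus "D' t > 0"
      using t by (simp add: zero_less_mult_iff)
  qed fact
  thus ?thesis
    by (simp add: D_def R_def Q_def f_def q_def)
qed


section \<open>Inequalities between consecutive Bessel functions, and concavity of their
  logarithm\<close>

lemma bessel_I_rec:
  assumes "x > 0"
  shows "bessel_I k x = bessel_I (k + 2) x + 2 * (real k + 1) / x * bessel_I (k + 1) x"
  using assms bessel_series_rec[of k "(x / 2)\<^sup>2"]
  by (simp add: bessel_I_eq field_simps power2_eq_square)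

lemma bessel_I_turan_ratio:
  assumes "x > 0"
  shows "bessel_I (k + 1) x ^ 3 * bessel_I (nat \<bar>int k - 1\<bar>) x < bessel_I k x ^ 3 * bessel_I (k + 2) x"
proof -
  define y where "y = x / 2"
  define F where "F i = bessel_series (k + i) (y\<^sup>2)" for i
  have "y > 0"
    using assms by (simp add: y_def)
  have F_pos: "F i > 0" for i
    by (simp add: F_def bessel_series_pos)
  have I: "bessel_I (k + i) x = y ^ (k + i) * F i" for i
    by (simp add: bessel_I_eq F_def y_def)
  \<comment> \<open>One formula covers both cases: for k > 0 it is the recurrence at k-1, and for k
    = 0 the first term vanishes and the reflected function I_1 remains.\<close>
  have below: "y * bessel_I (nat \<bar>int k - 1\<bar>) x = y ^ k * (real k * F 0 + y\<^sup>2 * F 1)"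
  proof (cases k)
    case 0
    thus ?thesis
      using I[of 1] by (simp add: power2_eq_square)
  next
    case (Suc j)
    have "bessel_series j (y\<^sup>2) = real k * F 0 + y\<^sup>2 * F 1"
      using bessel_series_rec[of j "y\<^sup>2"] by (simp add: F_def Suc add.commute)
    thus ?thesis
      using Suc by (simp add: bessel_I_eq y_def)
  qed
  have "real k * (F 1 / F 0) ^ 3 + y\<^sup>2 * (F 1 / F 0) ^ 4 < F 2 / F 0"
    using bessel_series_ratio_bound[of "y\<^sup>2" k] by (simp add: F_def)
  hence "(real k * (F 1 / F 0) ^ 3 + y\<^sup>2 * (F 1 / F 0) ^ 4) * F 0 ^ 4 < F 2 / F 0 * F 0 ^ 4"
    using F_pos[of 0] by (intro mult_strict_right_mono) auto
  hence "F 1 ^ 3 * (real k * F 0 + y\<^sup>2 * F 1) < F 0 ^ 3 * F 2"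
    using F_pos[of 0] by (simp add: power_divide distrib_right power_numeral_reduce)
      (simp add: algebra_simps)
  \<comment> \<open>Each product of four Bessel functions carries y^(4k+2); one more factor y comes
    from \<open>below\<close> and is cancelled at the end.\<close>
  hence "y ^ (4 * k + 3) * (F 1 ^ 3 * (real k * F 0 + y\<^sup>2 * F 1)) < y ^ (4 * k + 3) * (F 0 ^ 3 * F 2)"
    using \<open>y > 0\<close> by (intro mult_strict_left_mono) auto
  also have "y ^ (4 * k + 3) * (F 1 ^ 3 * (real k * F 0 + y\<^sup>2 * F 1)) =
      bessel_I (k + 1) x ^ 3 * (y ^ k * (real k * F 0 + y\<^sup>2 * F 1))"
    by (simp add: I[of 1, simplified] power_add power_mult power_mult_distrib power_numeral_reduce mult_ac)
  also have "\<dots> = y * (bessel_I (k + 1) x ^ 3 * bessel_I (nat \<bar>int k - 1\<bar>) x)"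
    unfolding below[symmetric] by (simp only: mult_ac)
  also have "y ^ (4 * k + 3) * (F 0 ^ 3 * F 2) = y * (bessel_I k x ^ 3 * bessel_I (k + 2) x)"
    by (simp add: I[of 0, simplified] I[of 2, simplified] power_add power_mult power_mult_distrib
        power_numeral_reduce mult_ac)
  finally show ?thesis
    using \<open>y > 0\<close> by simp
qed

text \<open>The negated second difference, so nonnegative curvature is discrete concavity.\<close>

definition curvature :: "(int \<Rightarrow> real) \<Rightarrow> int \<Rightarrow> real" where
  "curvature g k = 2 * g k - g (k + 1) - g (k - 1)"

text \<open>The difference of the two curvatures is a third difference of logarithms with
  coefficients 1, 3, 3, 1; its sign is the logarithm of \<open>bessel_I_turan_ratio\<close>.\<close>

lemma curvature_ln_bessel_I_antimono:
  fixes k :: int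
  assumes "x > 0" "k \<ge> 0"
  shows "curvature (\<lambda>k. ln (bessel_I (nat \<bar>k\<bar>) x)) (k + 1)
       \<le> curvature (\<lambda>k. ln (bessel_I (nat \<bar>k\<bar>) x)) k"
proof -
  obtain n where n: "k = int n"
    using \<open>k \<ge> 0\<close> nonneg_int_cases by blast
  define J where "J i = bessel_I (nat \<bar>int n + i\<bar>) x" for i
  have pos: "J i > 0" for i
    using assms by (simp add: J_def bessel_I_pos)
  have "J 1 ^ 3 * J (-1) \<le> J 0 ^ 3 * J 2"
    using bessel_I_turan_ratio[OF assms(1), of n] by (simp add: J_def nat_add_distrib)
  hence "ln (J 1 ^ 3 * J (-1)) \<le> ln (J 0 ^ 3 * J 2)"
    using pos by (subst ln_le_cancel_iff) auto
  hence "3 * ln (J 1) + ln (J (-1)) \<le> 3 * ln (J 0) + ln (J 2)"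
    using pos by (simp add: ln_mult ln_realpow less_imp_neq[symmetric])
  thus ?thesis
    by (simp add: curvature_def n J_def add.assoc)
qed

text \<open>If the curvature were negative somewhere it would stay so by monotonicity, and \<open>I_k / I_{k+1}\<close>
  would tend to 0; but the recurrence makes this ratio at least 1 for large \<open>k\<close>.\<close>

lemma curvature_ln_bessel_I_nonneg:
  assumes "x > 0"
  shows "curvature (\<lambda>k. ln (bessel_I (nat \<bar>k\<bar>) x)) k \<ge> 0"
proof -
  define g where "g k = ln (bessel_I (nat \<bar>k\<bar>) x)" for k
  define d where "d k = g k - g (k + 1)" for k
  have curv: "curvature g k = d k - d (k - 1)" for k
    by (simp add: curvature_def d_def)
  have nonneg: "curvature g (int n) \<ge> 0" for n
  proof (rule ccontr)
    assume neg: "\<not> curvature g (int n) \<ge> 0"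
    have curv_le: "curvature g (int (n + i)) \<le> curvature g (int n)" for i
    proof (induction i)
      case (Suc i)
      have "curvature g (int (n + i) + 1) \<le> curvature g (int (n + i))"
        unfolding g_def[abs_def] by (rule curvature_ln_bessel_I_antimono[OF assms]) simp
      with Suc show ?case
        by (simp add: add_ac)
    qed simp
    have d_le: "d (int (n + i)) \<le> d (int n) + real i * curvature g (int n)" for i
    proof (induction i)
      case (Suc i)
      show ?case
        using Suc curv_le[of "Suc i"] curv[of "int (n + Suc i)"] by (simp add: algebra_simps)
    qed simp
    \<comment> \<open>The first condition forces \<open>d\<close> to be negative at n+i; the second
      makes the coefficient 2(n+i+1)/x in the recurrence at least 1, which forces \<open>d\<close>
      to be nonnegative there.\<close>
    obtain i where i: "real i * (- curvature g (int n)) > d (int n)" "real i > x"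
    proof -
      obtain i1 where "real i1 * (- curvature g (int n)) > d (int n)"
        using reals_Archimedean3[of "- curvature g (int n)"] neg by auto
      moreover obtain i2 where "real i2 > x"
        using reals_Archimedean2 by blast
      moreover have "real i1 * (- curvature g (int n)) \<le> real (max i1 i2) * (- curvature g (int n))"
        using neg by (intro mult_right_mono) auto
      ultimately show ?thesis
        by (intro that[of "max i1 i2"]) auto
    qed
    let ?k = "n + i"
    have "1 * bessel_I (?k + 1) x \<le> 2 * (real ?k + 1) / x * bessel_I (?k + 1) x"
      using i assms by (intro mult_right_mono less_imp_le[OF bessel_I_pos]) (auto simp: field_simps)
    also have "\<dots> \<le> bessel_I ?k x"
      using bessel_I_rec[OF assms, of ?k] bessel_I_pos[OF assms, of "?k + 2"] by linarith
    finally have "d (int ?k) \<ge> 0"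
      using bessel_I_pos[OF assms] by (simp add: d_def g_def nat_add_distrib)
    with d_le[of i] i show False
      by simp
  qed
  have "curvature g k = curvature g \<bar>k\<bar>"
    unfolding curvature_def g_def
    by (cases "k \<ge> 0") (auto intro!: arg_cong[where f = "\<lambda>i. ln (bessel_I (nat i) x)"])
  thus ?thesis
    using nonneg[of "nat \<bar>k\<bar>"] unfolding g_def[abs_def] by simp
qed

section \<open>Four functions theorem and folding of integer-valued fields\<close>

text \<open>Indicators move the sums to full types, where Tonelli for counting measures holds
  without sigma-finiteness.\<close>

lemma nn_integral_count_space_Times:
  fixes f :: "'a \<Rightarrow> 'b \<Rightarrow> ennreal"
  shows "(\<integral>\<^sup>+p. f (fst p) (snd p) \<partial>count_space (A \<times> B)) =
    (\<integral>\<^sup>+x. \<integral>\<^sup>+y. f x y \<partial>count_space B \<partial>count_space A)"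
proof -
  have "(\<integral>\<^sup>+p. f (fst p) (snd p) \<partial>count_space (A \<times> B)) =
      (\<integral>\<^sup>+p. f (fst p) (snd p) * indicator (A \<times> B) p \<partial>count_space UNIV)"
    by (rule nn_integral_count_space_indicator) simp
  also have "\<dots> = (\<integral>\<^sup>+x. \<integral>\<^sup>+y. f x y * indicator (A \<times> B) (x, y) \<partial>count_space UNIV \<partial>count_space UNIV)"
    by (subst nn_integral_fst_count_space[symmetric]) simp
  also have "\<dots> = (\<integral>\<^sup>+x. (\<integral>\<^sup>+y. f x y * indicator B y \<partial>count_space UNIV) * indicator A x \<partial>count_space UNIV)"
    by (intro nn_integral_cong) (auto simp: indicator_def)
  finally show ?thesis
    by (simp add: nn_integral_count_space_indicator)
qed

lemma nn_integral_count_space_swap: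
  fixes f :: "'a \<Rightarrow> 'b \<Rightarrow> ennreal"
  shows "(\<integral>\<^sup>+x. \<integral>\<^sup>+y. f x y \<partial>count_space B \<partial>count_space A) =
    (\<integral>\<^sup>+y. \<integral>\<^sup>+x. f x y \<partial>count_space A \<partial>count_space B)"
proof -
  have "bij_betw prod.swap (A \<times> B) (B \<times> A)"
    by (rule bij_betwI[where g = prod.swap]) auto
  from nn_integral_bij_count_space[OF this, of "\<lambda>p. f (snd p) (fst p)"] show ?thesis
    unfolding nn_integral_count_space_Times[symmetric] by simp
qed

lemma nn_integral_PiE_dflt_insert:
  fixes f :: "('a \<Rightarrow> 'b) \<Rightarrow> ennreal"
  assumes "u \<notin> S"
  shows "(\<integral>\<^sup>+h. f h \<partial>count_space (PiE_dflt (insert u S) d (\<lambda>_. A))) =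
    (\<integral>\<^sup>+h. \<integral>\<^sup>+k. f (h(u := k)) \<partial>count_space A \<partial>count_space (PiE_dflt S d (\<lambda>_. A)))"
proof -
  have "bij_betw (\<lambda>p. (fst p)(u := snd p)) (PiE_dflt S d (\<lambda>_. A) \<times> A)
      (PiE_dflt (insert u S) d (\<lambda>_. A))"
    using assms
    by (intro bij_betwI[where g = "\<lambda>h. (h(u := d), h u)"]) (auto simp: PiE_dflt_def)
  from nn_integral_bij_count_space[OF this, of f] show ?thesis
    by (subst (asm) nn_integral_count_space_Times) simp
qed

lemma nn_integral_PiE_dflt_empty:
  "(\<integral>\<^sup>+h. f h \<partial>count_space (PiE_dflt {} d B)) = f (\<lambda>_. d)"
proof -
  have "PiE_dflt {} d B = {\<lambda>_. d}"
    by (auto simp: PiE_dflt_def)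
  thus ?thesis
    by (simp add: nn_integral_count_space_finite)
qed

text \<open>For finite values, (c-a)(c-b) \<ge> 0 gives c(a+b) \<le> c^2 + ab \<le> c(c+d).\<close>

lemma four_functions_two_points:
  fixes a b c d :: ennreal
  assumes "a \<le> c" "b \<le> c" "a * b \<le> c * d"
  shows "a + b \<le> c + d"
proof (cases "c = top \<or> d = top")
  case False
  then obtain c' d' where cd: "c = ennreal c'" "d = ennreal d'" "c' \<ge> 0" "d' \<ge> 0"
    by (metis ennreal_cases)
  moreover from False assms have "a \<noteq> top" "b \<noteq> top"
    by (auto simp: top_unique)
  then obtain a' b' where ab: "a = ennreal a'" "b = ennreal b'" "a' \<ge> 0" "b' \<ge> 0"
    by (metis ennreal_cases)
  ultimately have le: "a' \<le> c'" "b' \<le> c'" "a' * b' \<le> c' * d'"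
    using assms by (auto simp: ennreal_mult[symmetric])
  have "a' + b' \<le> c' + d'"
  proof (cases "c' = 0")
    case True
    thus ?thesis using le ab cd by simp
  next
    case False
    have "(c' - a') * (c' - b') \<ge> 0"
      using le by simp
    hence "c' * (a' + b') \<le> c' * (c' + d')"
      using le by (simp add: algebra_simps)
    thus ?thesis
      using False cd by (simp add: mult_le_cancel_left)
  qed
  thus ?thesis
    using ab cd by (simp flip: ennreal_plus)
qed auto

text \<open>Pairing the points \<open>(x, y)\<close> and \<open>(y, x)\<close> of the double sum avoids any truncation of the
  infinite chain.\<close>

lemma four_functions_chain:
  fixes \<alpha> \<beta> \<gamma> \<delta> :: "'a :: linorder \<Rightarrow> ennreal"
  assumes le: "\<And>x y. \<alpha> x * \<beta> y \<le> \<gamma> (max x y) * \<delta> (min x y)"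
  shows "(\<integral>\<^sup>+x. \<alpha> x \<partial>count_space UNIV) * (\<integral>\<^sup>+x. \<beta> x \<partial>count_space UNIV)
       \<le> (\<integral>\<^sup>+x. \<gamma> x \<partial>count_space UNIV) * (\<integral>\<^sup>+x. \<delta> x \<partial>count_space UNIV)"
proof -
  have pair: "\<alpha> x * \<beta> y + \<alpha> y * \<beta> x \<le> \<gamma> x * \<delta> y + \<gamma> y * \<delta> x" if "x \<le> y" for x y
  proof -
    \<comment> \<open>The hypothesis at (x, y) and (y, x) bounds each summand by
      \<open>\<gamma> y * \<delta> x\<close>; the diagonal points (x, x) and (y, y) bound the
      product of the summands.\<close>
    have "(\<alpha> x * \<beta> y) * (\<alpha> y * \<beta> x) \<le> (\<gamma> y * \<delta> x) * (\<gamma> x * \<delta> y)"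
      using mult_mono[OF le[of x x] le[of y y]] by (simp add: mult_ac)
    from four_functions_two_points[OF _ _ this] show ?thesis
      using le[of x y] le[of y x] that by (simp add: max_def min_def add.commute split: if_splits)
  qed
  have split: "(\<integral>\<^sup>+x. \<integral>\<^sup>+y. f x * g y + f y * g x \<partial>count_space UNIV \<partial>count_space UNIV) =
      2 * ((\<integral>\<^sup>+x. f x \<partial>count_space UNIV) * (\<integral>\<^sup>+x. g x \<partial>count_space UNIV))"
    for f g :: "'a \<Rightarrow> ennreal"
    by (simp add: nn_integral_add nn_integral_cmult nn_integral_multc mult_2 mult.commute)
  have "2 * ((\<integral>\<^sup>+x. \<alpha> x \<partial>count_space UNIV) * (\<integral>\<^sup>+x. \<beta> x \<partial>count_space UNIV))
      \<le> 2 * ((\<integral>\<^sup>+x. \<gamma> x \<partial>count_space UNIV) * (\<integral>\<^sup>+x. \<delta> x \<partial>count_space UNIV))"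
    unfolding split[symmetric]
  proof (intro nn_integral_mono)
    fix x y
    show "\<alpha> x * \<beta> y + \<alpha> y * \<beta> x \<le> \<gamma> x * \<delta> y + \<gamma> y * \<delta> x"
      using pair[of x y] pair[of y x] by (cases x y rule: le_cases) (auto simp: add.commute)
  qed
  thus ?thesis
    by (simp add: ennreal_mult_le_mult_iff)
qed

text \<open>Induction on the coordinates: summing out \<open>u\<close> leaves four functions on
  \<open>S\<close> whose hypothesis is the conclusion of
  \<open>four_functions_chain\<close>.\<close>

lemma four_functions:
  fixes \<alpha> \<beta> \<gamma> \<delta> :: "('a \<Rightarrow> 'b :: linorder) \<Rightarrow> ennreal"
  assumes "finite S"
    and "\<And>x y. x \<in> PiE_dflt S d (\<lambda>_. UNIV) \<Longrightarrow> y \<in> PiE_dflt S d (\<lambda>_. UNIV) \<Longrightarrow>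
      \<alpha> x * \<beta> y \<le> \<gamma> (\<lambda>u. max (x u) (y u)) * \<delta> (\<lambda>u. min (x u) (y u))"
  shows "(\<integral>\<^sup>+x. \<alpha> x \<partial>count_space (PiE_dflt S d (\<lambda>_. UNIV))) *
         (\<integral>\<^sup>+x. \<beta> x \<partial>count_space (PiE_dflt S d (\<lambda>_. UNIV)))
       \<le> (\<integral>\<^sup>+x. \<gamma> x \<partial>count_space (PiE_dflt S d (\<lambda>_. UNIV))) *
         (\<integral>\<^sup>+x. \<delta> x \<partial>count_space (PiE_dflt S d (\<lambda>_. UNIV)))"
  using assms
proof (induction S arbitrary: \<alpha> \<beta> \<gamma> \<delta> rule: finite_induct)
  case empty
  have "(\<lambda>_. d) \<in> PiE_dflt {} d (\<lambda>_. UNIV :: 'b set)"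
    by (simp add: PiE_dflt_def)
  from empty[OF this this] show ?case
    by (simp add: nn_integral_PiE_dflt_empty)
next
  case (insert u S)
  show ?case
    unfolding nn_integral_PiE_dflt_insert[OF insert.hyps(2)]
  proof (rule insert.IH, rule four_functions_chain)
    fix x y :: "'a \<Rightarrow> 'b" and k l
    assume "x \<in> PiE_dflt S d (\<lambda>_. UNIV)" "y \<in> PiE_dflt S d (\<lambda>_. UNIV)"
    hence "x(u := k) \<in> PiE_dflt (insert u S) d (\<lambda>_. UNIV)"
      "y(u := l) \<in> PiE_dflt (insert u S) d (\<lambda>_. UNIV)"
      by (auto simp: PiE_dflt_def)
    from insert.prems[OF this]
    have "\<alpha> (x(u := k)) * \<beta> (y(u := l)) \<le>
       \<gamma> (\<lambda>v. max ((x(u := k)) v) ((y(u := l)) v)) * \<delta> (\<lambda>v. min ((x(u := k)) v) ((y(u := l)) v))" .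
    also have "(\<lambda>v. max ((x(u := k)) v) ((y(u := l)) v)) = (\<lambda>v. max (x v) (y v))(u := max k l)"
      by auto
    also have "(\<lambda>v. min ((x(u := k)) v) ((y(u := l)) v)) = (\<lambda>v. min (x v) (y v))(u := min k l)"
      by auto
    finally show "\<alpha> (x(u := k)) * \<beta> (y(u := l)) \<le>
       \<gamma> ((\<lambda>v. max (x v) (y v))(u := max k l)) * \<delta> ((\<lambda>v. min (x v) (y v))(u := min k l))" .
  qed
qed

section \<open>Integer fields as absolute values with signs\<close>

definition signs :: "'a set \<Rightarrow> ('a \<Rightarrow> int) set" where
  "signs S = PiE_dflt S 1 (\<lambda>_. {1, -1})"

text \<open>Both signs represent the height 0, so each zero of \<open>n\<close> doubles the sum over the signs.\<close>

definition zero_factor :: "nat \<Rightarrow> ennreal" where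
  "zero_factor n = (if n = 0 then 1 / 2 else 1)"

lemma nn_integral_count_space_int_fold:
  fixes f :: "int \<Rightarrow> ennreal"
  shows "(\<integral>\<^sup>+k. f k \<partial>count_space UNIV) =
    (\<integral>\<^sup>+n. zero_factor n * (\<integral>\<^sup>+s. f (s * int n) \<partial>count_space {1, -1}) \<partial>count_space UNIV)"
proof -
  have "(\<integral>\<^sup>+k. f k \<partial>count_space UNIV) =
      (\<integral>\<^sup>+k. \<integral>\<^sup>+n. f k * indicator {n. nat \<bar>k\<bar> = n} n \<partial>count_space UNIV \<partial>count_space UNIV)"
  proof (intro nn_integral_cong)
    fix k :: int
    have "(\<integral>\<^sup>+n. f k * indicator {n. nat \<bar>k\<bar> = n} n \<partial>count_space UNIV) =
        (\<Sum>n\<in>{nat \<bar>k\<bar>}. f k * indicator {n. nat \<bar>k\<bar> = n} n)"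
      by (rule nn_integral_count_space') auto
    thus "f k = (\<integral>\<^sup>+n. f k * indicator {n. nat \<bar>k\<bar> = n} n \<partial>count_space UNIV)"
      by simp
  qed
  also have "\<dots> = (\<integral>\<^sup>+n. \<integral>\<^sup>+k. f k * indicator {n. nat \<bar>k\<bar> = n} n \<partial>count_space UNIV \<partial>count_space UNIV)"
    by (rule nn_integral_count_space_swap)
  also have "\<dots> = (\<integral>\<^sup>+n. zero_factor n * (\<integral>\<^sup>+s. f (s * int n) \<partial>count_space {1, -1}) \<partial>count_space UNIV)"
  proof (intro nn_integral_cong)
    fix n :: nat
    have "(\<integral>\<^sup>+k. f k * indicator {n. nat \<bar>k\<bar> = n} n \<partial>count_space UNIV) =
        (\<Sum>k\<in>{int n, - int n}. f k * indicator {n. nat \<bar>k\<bar> = n} n)"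
      by (rule nn_integral_count_space') auto
    also have "\<dots> = (\<Sum>k\<in>{int n, - int n}. f k)"
      by (rule sum.cong) auto
    also have "\<dots> = zero_factor n * (f (int n) + f (- int n))"
    proof (cases "n = 0")
      case True
      have "1 / 2 * (f 0 + f 0) = f 0"
        using ennreal_mult_divide_eq[of 2 "f 0"] ennreal_times_divide[of "f 0 * 2" 1 2]
        by (simp add: mult_2_right[symmetric] mult.commute)
      thus ?thesis
        using True by (simp add: zero_factor_def)
    qed (simp add: zero_factor_def)
    finally show "(\<integral>\<^sup>+k. f k * indicator {n. nat \<bar>k\<bar> = n} n \<partial>count_space UNIV) =
        zero_factor n * (\<integral>\<^sup>+s. f (s * int n) \<partial>count_space {1, -1})"
      by (simp add: nn_integral_count_space_finite)
  qed
  finally show ?thesis .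
qed

lemma nn_integral_int_field_fold:
  fixes f :: "('a \<Rightarrow> int) \<Rightarrow> ennreal"
  assumes "finite S"
  shows "(\<integral>\<^sup>+h. f h \<partial>count_space (PiE_dflt S 0 (\<lambda>_. UNIV))) =
    (\<integral>\<^sup>+n. (\<Prod>u\<in>S. zero_factor (n u)) * (\<integral>\<^sup>+\<sigma>. f (\<lambda>u. \<sigma> u * int (n u)) \<partial>count_space (signs S))
      \<partial>count_space (PiE_dflt S 0 (\<lambda>_. UNIV)))"
  using assms
proof (induction S arbitrary: f rule: finite_induct)
  case empty
  show ?case
    by (simp add: nn_integral_PiE_dflt_empty signs_def)
next
  case (insert u S)
  let ?X = "\<lambda>S. count_space (PiE_dflt S 0 (\<lambda>_. UNIV :: nat set))"
  let ?Q = "\<lambda>n. \<Prod>v\<in>S. zero_factor (n v)"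
  have Q: "(\<Prod>v\<in>insert u S. zero_factor ((n(u := m)) v)) = ?Q n * zero_factor m" for n m
  proof -
    have "(\<Prod>v\<in>S. zero_factor ((n(u := m)) v)) = ?Q n"
      using insert.hyps by (intro prod.cong) auto
    thus ?thesis
      using insert.hyps by (simp del: fun_upd_apply) (simp add: mult.commute)
  qed
  have upd: "(\<lambda>v. (\<sigma>(u := s)) v * int ((n(u := m)) v)) = (\<lambda>v. \<sigma> v * int (n v))(u := s * int m)"
    for \<sigma> n s m by auto
  have "(\<integral>\<^sup>+h. f h \<partial>count_space (PiE_dflt (insert u S) 0 (\<lambda>_. UNIV))) =
      (\<integral>\<^sup>+h. \<integral>\<^sup>+m. zero_factor m * (\<integral>\<^sup>+s. f (h(u := s * int m)) \<partial>count_space {1, -1})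
        \<partial>count_space UNIV \<partial>count_space (PiE_dflt S 0 (\<lambda>_. UNIV)))"
    unfolding nn_integral_PiE_dflt_insert[OF insert.hyps(2)]
    by (simp add: nn_integral_count_space_int_fold)
  also have "\<dots> = (\<integral>\<^sup>+n. ?Q n * (\<integral>\<^sup>+\<sigma>. \<integral>\<^sup>+m. zero_factor m *
      (\<integral>\<^sup>+s. f ((\<lambda>v. \<sigma> v * int (n v))(u := s * int m)) \<partial>count_space {1, -1})
      \<partial>count_space UNIV \<partial>count_space (signs S)) \<partial>?X S)"
    by (rule insert.IH)
  also have "\<dots> = (\<integral>\<^sup>+n. \<integral>\<^sup>+m. ?Q n * zero_factor m * (\<integral>\<^sup>+\<sigma>.
      \<integral>\<^sup>+s. f ((\<lambda>v. \<sigma> v * int (n v))(u := s * int m)) \<partial>count_space {1, -1}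
      \<partial>count_space (signs S)) \<partial>count_space UNIV \<partial>?X S)"
    by (subst nn_integral_count_space_swap) (simp add: nn_integral_cmult mult.assoc)
  also have "\<dots> = (\<integral>\<^sup>+n. (\<Prod>v\<in>insert u S. zero_factor (n v)) *
      (\<integral>\<^sup>+\<sigma>. f (\<lambda>v. \<sigma> v * int (n v)) \<partial>count_space (signs (insert u S))) \<partial>?X (insert u S))"
    unfolding nn_integral_PiE_dflt_insert[OF insert.hyps(2)] signs_def Q upd ..
  finally show ?case .
qed

section \<open>Ginibre inequality for the Ising model\<close>

text \<open>The default spin 1 outside \<open>S\<close> makes the configurations a group of
  involutions under pointwise multiplication, and keeps every bond equal to 1 or -1 even when an
  endpoint lies outside \<open>S\<close>.\<close>

lemma finite_signs: "finite S \<Longrightarrow> finite (signs S)"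
  unfolding signs_def by (rule finite_PiE_dflt) auto

lemma signs_cases: "\<sigma> \<in> signs S \<Longrightarrow> \<sigma> u = 1 \<or> \<sigma> u = -1"
  by (auto simp: signs_def PiE_dflt_def)

lemma signs_mult: "\<sigma> \<in> signs S \<Longrightarrow> \<omega> \<in> signs S \<Longrightarrow> (\<lambda>u. \<sigma> u * \<omega> u) \<in> signs S"
  by (simp add: signs_def PiE_dflt_def) (metis minus_minus mult_1 mult_minus_left)

lemma bij_betw_signs_mult:
  assumes "\<omega> \<in> signs S"
  shows "bij_betw (\<lambda>\<sigma> u. \<sigma> u * \<omega> u) (signs S) (signs S)"
proof -
  have "\<omega> u * \<omega> u = 1" for u
    using signs_cases[OF assms, of u] by auto
  thus ?thesis
    using assms
    by (intro bij_betwI[where g = "\<lambda>\<sigma> u. \<sigma> u * \<omega> u"]) (auto simp: signs_mult mult.assoc)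
qed

text \<open>Lists permit repeated sites, so a product of monomials is a concatenation and squares of
  spins never have to be reduced.\<close>

definition spin_monomial :: "'a list \<Rightarrow> ('a \<Rightarrow> int) \<Rightarrow> real" where
  "spin_monomial us \<sigma> = (\<Prod>u\<leftarrow>us. real_of_int (\<sigma> u))"

lemma spin_monomial_append: "spin_monomial (us @ vs) \<sigma> = spin_monomial us \<sigma> * spin_monomial vs \<sigma>"
  by (simp add: spin_monomial_def)

lemma spin_monomial_mult:
  "spin_monomial us (\<lambda>u. \<sigma> u * \<omega> u) = spin_monomial us \<sigma> * spin_monomial us \<omega>"
  by (induction us) (simp_all add: spin_monomial_def)

text \<open>The cone of spin polynomials with nonnegative coefficients.\<close>

inductive ferromagnetic :: "(('a \<Rightarrow> int) \<Rightarrow> real) \<Rightarrow> bool" where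
  monomial: "c \<ge> 0 \<Longrightarrow> ferromagnetic (\<lambda>\<sigma>. c * spin_monomial us \<sigma>)"
| add: "ferromagnetic f \<Longrightarrow> ferromagnetic g \<Longrightarrow> ferromagnetic (\<lambda>\<sigma>. f \<sigma> + g \<sigma>)"

lemma ferromagnetic_const: "c \<ge> 0 \<Longrightarrow> ferromagnetic (\<lambda>_. c)"
  using ferromagnetic.monomial[of c "[]"] by (simp add: spin_monomial_def)

lemma ferromagnetic_pair: "c \<ge> 0 \<Longrightarrow> ferromagnetic (\<lambda>\<sigma>. c * real_of_int (\<sigma> u * \<sigma> v))"
  using ferromagnetic.monomial[of c "[u, v]"] by (simp add: spin_monomial_def)

lemma ferromagnetic_mult:
  assumes "ferromagnetic f" "ferromagnetic g"
  shows "ferromagnetic (\<lambda>\<sigma>. f \<sigma> * g \<sigma>)"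
  using assms
proof (induction rule: ferromagnetic.induct)
  case (monomial c us)
  from monomial(2) show ?case
  proof (induction rule: ferromagnetic.induct)
    case (monomial d vs)
    have "ferromagnetic (\<lambda>\<sigma>. (c * d) * spin_monomial (us @ vs) \<sigma>)"
      using monomial \<open>c \<ge> 0\<close> by (intro ferromagnetic.monomial) simp
    thus ?case
      by (simp add: spin_monomial_append mult_ac)
  qed (simp add: distrib_left ferromagnetic.add)
qed (simp add: distrib_right ferromagnetic.add)

text \<open>Griffiths' first inequality. A monomial is a character of the sign group: if it is
  negative at some \<omega>, translation by \<omega> shows that its sum is a negative multiple of
  itself, hence 0.\<close>

lemma ferromagnetic_sum_nonneg:
  assumes "ferromagnetic f"
  shows "(\<Sum>\<sigma>\<in>signs S. f \<sigma>) \<ge> 0"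
  using assms
proof (induction rule: ferromagnetic.induct)
  case (monomial c us)
  have "(\<Sum>\<sigma>\<in>signs S. spin_monomial us \<sigma>) \<ge> 0"
  proof (cases "\<forall>\<omega>\<in>signs S. spin_monomial us \<omega> \<ge> 0")
    case True
    thus ?thesis by (simp add: sum_nonneg)
  next
    case False
    then obtain \<omega> where \<omega>: "\<omega> \<in> signs S" "spin_monomial us \<omega> < 0"
      by force
    have "(\<Sum>\<sigma>\<in>signs S. spin_monomial us \<sigma>) = (\<Sum>\<sigma>\<in>signs S. spin_monomial us (\<lambda>u. \<sigma> u * \<omega> u))"
      by (rule sum.reindex_bij_betw[OF bij_betw_signs_mult[OF \<omega>(1)], symmetric])
    also have "\<dots> = spin_monomial us \<omega> * (\<Sum>\<sigma>\<in>signs S. spin_monomial us \<sigma>)"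
      by (simp add: spin_monomial_mult sum_distrib_left mult.commute)
    finally show ?thesis
      using \<omega>(2) by (smt (verit) mult_neg_neg mult_cancel_right1)
  qed
  thus ?case
    using monomial by (simp add: sum_distrib_left[symmetric])
qed (simp add: sum.distrib)

text \<open>From 2(ab + a'b') = (a+a')(b+b') + (a-a')(b-b') and 2(ab - a'b') = (a+a')(b-b') +
  (a-a')(b+b'). Each identity uses both signs, so the two claims are proved in one
  induction.\<close>

lemma ferromagnetic_prod_plus_minus:
  assumes "finite E"
    and "\<And>e. e \<in> E \<Longrightarrow> ferromagnetic (\<lambda>\<sigma>. F e \<sigma> + G e \<sigma>)"
    and "\<And>e. e \<in> E \<Longrightarrow> ferromagnetic (\<lambda>\<sigma>. F e \<sigma> - G e \<sigma>)"
  shows "ferromagnetic (\<lambda>\<sigma>. (\<Prod>e\<in>E. F e \<sigma>) + (\<Prod>e\<in>E. G e \<sigma>))"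
    and "ferromagnetic (\<lambda>\<sigma>. (\<Prod>e\<in>E. F e \<sigma>) - (\<Prod>e\<in>E. G e \<sigma>))"
proof -
  have half: "ferromagnetic (\<lambda>\<sigma>. 1 / 2 * (f \<sigma> * g \<sigma> + f' \<sigma> * g' \<sigma>))"
    if "ferromagnetic f" "ferromagnetic g" "ferromagnetic f'" "ferromagnetic g'"
    for f g f' g' :: "('b \<Rightarrow> int) \<Rightarrow> real"
    using that by (intro ferromagnetic_mult ferromagnetic.add ferromagnetic_const) auto
  from assms have "ferromagnetic (\<lambda>\<sigma>. (\<Prod>e\<in>E. F e \<sigma>) + (\<Prod>e\<in>E. G e \<sigma>)) \<and>
    ferromagnetic (\<lambda>\<sigma>. (\<Prod>e\<in>E. F e \<sigma>) - (\<Prod>e\<in>E. G e \<sigma>))"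
  proof (induction E rule: finite_induct)
    case empty
    show ?case
      using ferromagnetic_const[of 2] ferromagnetic_const[of 0] by simp
  next
    case (insert e E)
    let ?F = "\<lambda>\<sigma>. \<Prod>e\<in>E. F e \<sigma>" and ?G = "\<lambda>\<sigma>. \<Prod>e\<in>E. G e \<sigma>"
    have IH: "ferromagnetic (\<lambda>\<sigma>. ?F \<sigma> + ?G \<sigma>)" "ferromagnetic (\<lambda>\<sigma>. ?F \<sigma> - ?G \<sigma>)"
      using insert by auto
    have e: "ferromagnetic (\<lambda>\<sigma>. F e \<sigma> + G e \<sigma>)" "ferromagnetic (\<lambda>\<sigma>. F e \<sigma> - G e \<sigma>)"
      using insert.prems by auto
    show ?case
      using half[OF e(1) IH(1) e(2) IH(2)] half[OF e(1) IH(2) e(2) IH(1)] insert.hyps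
      by (simp add: algebra_simps)
  qed
  thus "ferromagnetic (\<lambda>\<sigma>. (\<Prod>e\<in>E. F e \<sigma>) + (\<Prod>e\<in>E. G e \<sigma>))"
    and "ferromagnetic (\<lambda>\<sigma>. (\<Prod>e\<in>E. F e \<sigma>) - (\<Prod>e\<in>E. G e \<sigma>))" by auto
qed

lemma ferromagnetic_prod:
  assumes "finite E" "\<And>e. e \<in> E \<Longrightarrow> ferromagnetic (F e)"
  shows "ferromagnetic (\<lambda>\<sigma>. \<Prod>e\<in>E. F e \<sigma>)"
  using assms
  by (induction E rule: finite_induct) (simp_all add: ferromagnetic_const ferromagnetic_mult)

section \<open>The Ising sum as a function of its couplings\<close>

definition bond :: "'a \<times> 'a \<Rightarrow> ('a \<Rightarrow> int) \<Rightarrow> real" where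
  "bond p \<sigma> = real_of_int (\<sigma> (fst p) * \<sigma> (snd p))"

definition gibbs_weight :: "'e set \<Rightarrow> ('e \<Rightarrow> 'a \<times> 'a) \<Rightarrow> ('e \<Rightarrow> real) \<Rightarrow> ('a \<Rightarrow> int) \<Rightarrow> real" where
  "gibbs_weight E d J \<sigma> = (\<Prod>e\<in>E. exp (J e * bond (d e) \<sigma>))"

definition ising_sum :: "'a set \<Rightarrow> 'e set \<Rightarrow> ('e \<Rightarrow> 'a \<times> 'a) \<Rightarrow> ('e \<Rightarrow> real) \<Rightarrow> real" where
  "ising_sum S E d J = (\<Sum>\<sigma>\<in>signs S. gibbs_weight E d J \<sigma>)"

lemma bond_cases: "\<sigma> \<in> signs S \<Longrightarrow> bond p \<sigma> = 1 \<or> bond p \<sigma> = -1"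
  using signs_cases[of \<sigma> S "fst p"] signs_cases[of \<sigma> S "snd p"] by (auto simp: bond_def)

lemma bond_mult: "bond p (\<lambda>u. \<sigma> u * \<omega> u) = bond p \<omega> * bond p \<sigma>"
  by (simp add: bond_def)

lemma ferromagnetic_bond: "a \<ge> 0 \<Longrightarrow> c \<ge> 0 \<Longrightarrow> ferromagnetic (\<lambda>\<sigma>. a + c * bond p \<sigma>)"
  unfolding bond_def by (intro ferromagnetic.add ferromagnetic_const ferromagnetic_pair)

text \<open>This linearisation turns a Gibbs weight with nonnegative couplings into a product of
  ferromagnetic factors.\<close>

lemma exp_bond:
  assumes "b = 1 \<or> b = -1"
  shows "exp (J * b) = cosh J + sinh J * (b :: real)"
  using assms by (auto simp: cosh_plus_sinh cosh_minus_sinh)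

lemma gibbs_weight_add:
  "gibbs_weight E d (\<lambda>e. J e + K e) \<sigma> = gibbs_weight E d J \<sigma> * gibbs_weight E d K \<sigma>"
  by (simp add: gibbs_weight_def distrib_right exp_add prod.distrib)

lemma gibbs_weight_eq:
  assumes "\<sigma> \<in> signs S"
  shows "gibbs_weight E d J \<sigma> = (\<Prod>e\<in>E. cosh (J e) + sinh (J e) * bond (d e) \<sigma>)"
  unfolding gibbs_weight_def using bond_cases[OF assms] by (intro prod.cong refl exp_bond)

lemma ising_sum_mono:
  assumes "finite E" and J: "\<And>e. e \<in> E \<Longrightarrow> 0 \<le> J e" and JK: "\<And>e. e \<in> E \<Longrightarrow> J e \<le> K e"
  shows "ising_sum S E d J \<le> ising_sum S E d K"
proof -
  define D where "D e = K e - J e" for e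
  have D: "D e \<ge> 0" if "e \<in> E" for e
    using JK[OF that] by (simp add: D_def)
  have "ising_sum S E d K - ising_sum S E d J =
      (\<Sum>\<sigma>\<in>signs S. gibbs_weight E d J \<sigma> * (gibbs_weight E d D \<sigma> - 1))"
    using gibbs_weight_add[of E d J D]
    by (simp add: ising_sum_def D_def sum_subtractf right_diff_distrib)
  \<comment> \<open>The constant 1 is written as a product over \<open>E\<close> so that
    \<open>ferromagnetic_prod_plus_minus\<close> applies; the minus case rests on cosh \<ge>
    1.\<close>
  also have "\<dots> = (\<Sum>\<sigma>\<in>signs S. (\<Prod>e\<in>E. cosh (J e) + sinh (J e) * bond (d e) \<sigma>) *
      ((\<Prod>e\<in>E. cosh (D e) + sinh (D e) * bond (d e) \<sigma>) - (\<Prod>e\<in>E. 1)))"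
    by (intro sum.cong) (simp_all add: gibbs_weight_eq)
  also have "\<dots> \<ge> 0"
  proof (intro ferromagnetic_sum_nonneg ferromagnetic_mult ferromagnetic_prod
      ferromagnetic_prod_plus_minus ferromagnetic_bond \<open>finite E\<close>)
    fix e assume "e \<in> E"
    show "ferromagnetic (\<lambda>\<sigma>. cosh (D e) + sinh (D e) * bond (d e) \<sigma> + 1)"
      using ferromagnetic_bond[of "cosh (D e) + 1" "sinh (D e)" "d e"] D[OF \<open>e \<in> E\<close>]
      by (simp add: add_ac add_nonneg_nonneg)
    show "ferromagnetic (\<lambda>\<sigma>. cosh (D e) + sinh (D e) * bond (d e) \<sigma> - 1)"
      using ferromagnetic_bond[of "cosh (D e) - 1" "sinh (D e)" "d e"] D[OF \<open>e \<in> E\<close>]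
      by (simp add: algebra_simps cosh_real_ge_1)
  qed (use J in auto)
  finally show ?thesis by simp
qed

text \<open>Ginibre's duplication argument: the second replica is written as the pointwise product of
  the first replica with a fixed spin configuration.\<close>

lemma ising_sum_supermodular:
  assumes "finite E"
    and j: "\<And>e. e \<in> E \<Longrightarrow> 0 \<le> j e" and x: "\<And>e. e \<in> E \<Longrightarrow> 0 \<le> x e" and y: "\<And>e. e \<in> E \<Longrightarrow> 0 \<le> y e"
  shows "ising_sum S E d (\<lambda>e. j e + x e) * ising_sum S E d (\<lambda>e. j e + y e)
       \<le> ising_sum S E d (\<lambda>e. j e + x e + y e) * ising_sum S E d j"
proof -
  define W where "W J = gibbs_weight E d J" for J
  \<comment> \<open>The duplicated form of a covariance: the double sum of \<open>T\<close> is twice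
    the difference of the two sides.\<close>
  define T where "T \<sigma> \<tau> = W j \<sigma> * W j \<tau> * ((W x \<sigma> - W x \<tau>) * (W y \<sigma> - W y \<tau>))" for \<sigma> \<tau>
  have double: "2 * (a * b - a' * b') = a * b + b * a - (a' * b' + b' * a')" for a b a' b' :: real
    by simp
  have "2 * (ising_sum S E d (\<lambda>e. j e + x e + y e) * ising_sum S E d j
      - ising_sum S E d (\<lambda>e. j e + x e) * ising_sum S E d (\<lambda>e. j e + y e))
      = (\<Sum>\<sigma>\<in>signs S. \<Sum>\<tau>\<in>signs S.
          (W j \<sigma> * W x \<sigma> * W y \<sigma> * W j \<tau> + W j \<sigma> * (W j \<tau> * W x \<tau> * W y \<tau>))
          - (W j \<sigma> * W x \<sigma> * (W j \<tau> * W y \<tau>) + W j \<sigma> * W y \<sigma> * (W j \<tau> * W x \<tau>)))"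
    unfolding double unfolding ising_sum_def W_def gibbs_weight_add sum_product sum.distrib sum_subtractf ..
  also have "\<dots> = (\<Sum>\<sigma>\<in>signs S. \<Sum>\<tau>\<in>signs S. T \<sigma> \<tau>)"
    by (intro sum.cong refl) (simp add: T_def algebra_simps)
  also have "\<dots> = (\<Sum>\<sigma>\<in>signs S. \<Sum>\<omega>\<in>signs S. T \<sigma> (\<lambda>u. \<sigma> u * \<omega> u))"
  proof (rule sum.cong[OF refl])
    fix \<sigma> assume "\<sigma> \<in> signs S"
    from sum.reindex_bij_betw[OF bij_betw_signs_mult[OF this], of "T \<sigma>"]
    show "(\<Sum>\<tau>\<in>signs S. T \<sigma> \<tau>) = (\<Sum>\<omega>\<in>signs S. T \<sigma> (\<lambda>u. \<sigma> u * \<omega> u))"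
      by (simp add: mult.commute)
  qed
  also have "\<dots> = (\<Sum>\<omega>\<in>signs S. \<Sum>\<sigma>\<in>signs S. T \<sigma> (\<lambda>u. \<sigma> u * \<omega> u))"
    by (rule sum.swap)
  also have "\<dots> \<ge> 0"
  proof (rule sum_nonneg)
    fix \<omega> assume \<omega>: "\<omega> \<in> signs S"
    define b where "b e = bond (d e) \<omega>" for e
    have b: "b e = 1 \<or> b e = -1" for e
      unfolding b_def by (rule bond_cases[OF \<omega>])
    \<comment> \<open>With \<omega> fixed, the weight of the second replica is a polynomial in the
      spins of the first, whose bond coefficients are multiplied by the signs
      \<open>b\<close>.\<close>
    define P where "P c J \<sigma> = (\<Prod>e\<in>E. cosh (J e) + sinh (J e) * c e * bond (d e) \<sigma>)"
      for c J :: "'a \<Rightarrow> real" and \<sigma>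
    have W: "W J \<sigma> = P (\<lambda>_. 1) J \<sigma>" "W J (\<lambda>u. \<sigma> u * \<omega> u) = P b J \<sigma>"
      if "\<sigma> \<in> signs S" for J \<sigma>
      using that \<omega>
      by (simp_all add: W_def gibbs_weight_eq[where S = S] signs_mult P_def bond_mult b_def mult.assoc)
    \<comment> \<open>The common factors of the two replicas merge into couplings j(1+b), equal to 0
      or 2j and so still ferromagnetic.\<close>
    have WW: "W j \<sigma> * W j (\<lambda>u. \<sigma> u * \<omega> u) = P (\<lambda>_. 1) (\<lambda>e. j e * (1 + b e)) \<sigma>"
      if "\<sigma> \<in> signs S" for \<sigma>
      unfolding W(1)[OF that, symmetric]
      by (simp add: W_def gibbs_weight_def bond_mult b_def distrib_left distrib_right exp_add
          prod.distrib mult.assoc)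
    have diff: "ferromagnetic (\<lambda>\<sigma>. P (\<lambda>_. 1) J \<sigma> - P b J \<sigma>)"
      if J: "\<And>e. e \<in> E \<Longrightarrow> 0 \<le> J e" for J
      unfolding P_def
    proof (intro ferromagnetic_prod_plus_minus \<open>finite E\<close>)
      fix e assume "e \<in> E"
      have nonneg: "0 \<le> sinh (J e) * (1 + b e)" "0 \<le> sinh (J e) * (1 - b e)"
        using J[OF \<open>e \<in> E\<close>] b[of e] by auto
      show "ferromagnetic (\<lambda>\<sigma>. cosh (J e) + sinh (J e) * 1 * bond (d e) \<sigma> +
          (cosh (J e) + sinh (J e) * b e * bond (d e) \<sigma>))"
        using ferromagnetic_bond[OF _ nonneg(1), of "2 * cosh (J e)" "d e"]
        by (simp add: algebra_simps)
      show "ferromagnetic (\<lambda>\<sigma>. cosh (J e) + sinh (J e) * 1 * bond (d e) \<sigma> -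
          (cosh (J e) + sinh (J e) * b e * bond (d e) \<sigma>))"
        using ferromagnetic_bond[OF _ nonneg(2), of 0 "d e"]
        by (simp add: algebra_simps)
    qed
    have j': "0 \<le> j e * (1 + b e)" if "e \<in> E" for e
      using j[OF that] b[of e] by auto
    have "(\<Sum>\<sigma>\<in>signs S. T \<sigma> (\<lambda>u. \<sigma> u * \<omega> u)) = (\<Sum>\<sigma>\<in>signs S. P (\<lambda>_. 1) (\<lambda>e. j e * (1 + b e)) \<sigma> *
        ((P (\<lambda>_. 1) x \<sigma> - P b x \<sigma>) * (P (\<lambda>_. 1) y \<sigma> - P b y \<sigma>)))"
      by (intro sum.cong refl) (simp only: T_def WW, simp add: W)
    also have "\<dots> \<ge> 0"
    proof (intro ferromagnetic_sum_nonneg ferromagnetic_mult diff x y)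
      show "ferromagnetic (P (\<lambda>_. 1) (\<lambda>e. j e * (1 + b e)))"
        unfolding P_def[abs_def] using j'
        by (intro ferromagnetic_prod \<open>finite E\<close> ferromagnetic_bond) auto
    qed
    finally show "0 \<le> (\<Sum>\<sigma>\<in>signs S. T \<sigma> (\<lambda>u. \<sigma> u * \<omega> u))" .
  qed
  finally show ?thesis by simp
qed

section \<open>Absolute-value FKG inequality\<close>

text \<open>Unit squares add up to rectangles, which settles incomparable pairs; for comparable
  pairs both sides agree.\<close>

lemma supermodular_natI:
  fixes f :: "nat \<Rightarrow> nat \<Rightarrow> real"
  assumes mixed: "\<And>a b. f (Suc a) b + f a (Suc b) \<le> f (Suc a) (Suc b) + f a b"
  shows "f a b + f a' b' \<le> f (max a a') (max b b') + f (min a a') (min b b')"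
proof -
  have row: "f (a + i) b + f a (Suc b) \<le> f (a + i) (Suc b) + f a b" for a b i
  proof (induction i)
    case (Suc i)
    thus ?case using mixed[of "a + i" b] by simp
  qed simp
  have rect: "f (a + i) b + f a (b + j) \<le> f (a + i) (b + j) + f a b" for a b i j
  proof (induction j)
    case (Suc j)
    thus ?case using row[of a i "b + j"] by simp
  qed simp
  consider "a \<le> a'" "b \<le> b'" | "a' \<le> a" "b' \<le> b" | "a \<le> a'" "b' \<le> b" | "a' \<le> a" "b \<le> b'"
    by linarith
  thus ?thesis
  proof cases
    case 3
    with rect[of a "a' - a" b' "b - b'"] show ?thesis by (simp add: max_def min_def)
  next
    case 4
    with rect[of a' "a - a'" b "b' - b"] show ?thesis by (simp add: max_def min_def)
  qed (simp_all add: max_absorb1 max_absorb2 min_absorb1 min_absorb2)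
qed

text \<open>For heights of absolute values \<open>a\<close> and \<open>b\<close> and relative sign \<open>s\<close>, the log-weight of an
  edge is \<open>mean_weight g a b + s * coupling g a b\<close>.\<close>

definition coupling :: "(int \<Rightarrow> real) \<Rightarrow> nat \<Rightarrow> nat \<Rightarrow> real" where
  "coupling g a b = (g (int a - int b) - g (int a + int b)) / 2"

definition mean_weight :: "(int \<Rightarrow> real) \<Rightarrow> nat \<Rightarrow> nat \<Rightarrow> real" where
  "mean_weight g a b = (g (int a - int b) + g (int a + int b)) / 2"

definition field_weight :: "(int \<Rightarrow> real) \<Rightarrow> 'e set \<Rightarrow> ('e \<Rightarrow> 'a \<times> 'a) \<Rightarrow> ('a \<Rightarrow> int) \<Rightarrow> real" where
  "field_weight g E d h = (\<Prod>e\<in>E. exp (g (h (fst (d e)) - h (snd (d e)))))"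

definition abs_weight :: "(int \<Rightarrow> real) \<Rightarrow> 'a set \<Rightarrow> 'e set \<Rightarrow> ('e \<Rightarrow> 'a \<times> 'a) \<Rightarrow> ('a \<Rightarrow> nat) \<Rightarrow> real" where
  "abs_weight g S E d n = (\<Sum>\<sigma>\<in>signs S. field_weight g E d (\<lambda>u. \<sigma> u * int (n u)))"

locale decreasing_curvature =
  fixes g :: "int \<Rightarrow> real"
  assumes even: "g (- k) = g k"
    and curvature_nonneg: "curvature g k \<ge> 0"
    and curvature_step: "k \<ge> 0 \<Longrightarrow> curvature g (k + 1) \<le> curvature g k"
begin

lemma curvature_antimono:
  assumes "\<bar>k\<bar> \<le> l"
  shows "curvature g l \<le> curvature g k"
proof -
  have "curvature g l \<le> curvature g \<bar>k\<bar>"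
    using assms
  proof (induction l rule: int_ge_induct)
    case (step i)
    have "curvature g (i + 1) \<le> curvature g i"
      using step.hyps by (intro curvature_step) auto
    with step.IH show ?case by simp
  qed simp
  moreover have "curvature g (- k) = curvature g k"
  proof -
    have "- k + 1 = - (k - 1)" "- k - 1 = - (k + 1)"
      by simp_all
    thus ?thesis
      by (simp only: curvature_def even)
  qed
  ultimately show ?thesis
    by (simp add: abs_if split: if_splits)
qed

text \<open>The mixed difference is half of
  \<open>curvature g (a - b) + curvature g (a + b + 1)\<close>.\<close>

lemma coupling_mixed:
  "coupling g (Suc a) b + coupling g a (Suc b) \<le> coupling g (Suc a) (Suc b) + coupling g a b"
  using curvature_nonneg[of "int a - int b"] curvature_nonneg[of "int a + int b + 1"]
  by (simp add: coupling_def curvature_def field_simps)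

lemmas coupling_supermodular = supermodular_natI[of "coupling g", OF coupling_mixed]

text \<open>Here the mixed difference is half of
  \<open>curvature g (a - b) - curvature g (a + b + 1)\<close>, so the decrease of the curvature
  away from 0 enters.\<close>

lemma mean_weight_supermodular:
  "mean_weight g a b + mean_weight g a' b'
    \<le> mean_weight g (max a a') (max b b') + mean_weight g (min a a') (min b b')"
proof (rule supermodular_natI)
  fix a b
  have "\<bar>int a - int b\<bar> \<le> int a + int b + 1"
    by linarith
  from curvature_antimono[OF this]
  show "mean_weight g (Suc a) b + mean_weight g a (Suc b) \<le> mean_weight g (Suc a) (Suc b) + mean_weight g a b"
    by (simp add: mean_weight_def curvature_def field_simps)
qed

lemma coupling_commute: "coupling g a b = coupling g b a"
  using even[of "int a - int b"] by (simp add: coupling_def add.commute)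

lemma coupling_0_right: "coupling g a 0 = 0"
  by (simp add: coupling_def)

text \<open>Supermodularity for the points (a, b) and (a', 0), as the coupling vanishes when one
  height is 0.\<close>

lemma coupling_mono_left: "a \<le> a' \<Longrightarrow> coupling g a b \<le> coupling g a' b"
  using coupling_supermodular[of a b a' 0]
  by (cases "b = 0") (simp_all add: coupling_0_right max_def min_def)

lemma coupling_mono: "a \<le> a' \<Longrightarrow> b \<le> b' \<Longrightarrow> coupling g a b \<le> coupling g a' b'"
  by (metis coupling_commute coupling_mono_left order_trans)

lemma coupling_nonneg: "coupling g a b \<ge> 0"
  using coupling_mono[of 0 a 0 b] by (simp add: coupling_0_right)

lemma field_weight_signs:
  assumes "\<sigma> \<in> signs S"
  shows "field_weight g E d (\<lambda>u. \<sigma> u * int (n u)) =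
    exp (\<Sum>e\<in>E. mean_weight g (n (fst (d e))) (n (snd (d e)))) *
    gibbs_weight E d (\<lambda>e. coupling g (n (fst (d e))) (n (snd (d e)))) \<sigma>"
proof -
  have "g (\<sigma> u * int a - \<sigma> v * int b) = mean_weight g a b + coupling g a b * bond (u, v) \<sigma>" for u v a b
    using signs_cases[OF assms, of u] signs_cases[OF assms, of v]
      even[of "int a - int b"] even[of "int a + int b"]
    by (auto simp: mean_weight_def coupling_def bond_def field_simps)
  hence "field_weight g E d (\<lambda>u. \<sigma> u * int (n u)) = (\<Prod>e\<in>E.
      exp (mean_weight g (n (fst (d e))) (n (snd (d e)))) *
      exp (coupling g (n (fst (d e))) (n (snd (d e))) * bond (d e) \<sigma>))"
    by (simp add: field_weight_def exp_add)
  thus ?thesis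
    by (cases "finite E") (simp_all add: prod.distrib gibbs_weight_def exp_sum)
qed

lemma abs_weight_supermodular:
  assumes "finite E"
  shows "abs_weight g S E d n * abs_weight g S E d m
    \<le> abs_weight g S E d (\<lambda>u. max (n u) (m u)) * abs_weight g S E d (\<lambda>u. min (n u) (m u))"
proof -
  define L where "L n = (\<Sum>e\<in>E. mean_weight g (n (fst (d e))) (n (snd (d e))))" for n
  define K where "K n e = coupling g (n (fst (d e))) (n (snd (d e)))" for n e
  define Z where "Z J = ising_sum S E d J" for J
  have weight: "abs_weight g S E d n = exp (L n) * Z (K n)" for n
    by (simp add: abs_weight_def field_weight_signs[where S = S] sum_distrib_left
        Z_def ising_sum_def L_def K_def[abs_def])
  define p where "p = (\<lambda>u. max (n u) (m u))"
  define q where "q = (\<lambda>u. min (n u) (m u))"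
  have "L n + L m \<le> L p + L q"
    unfolding L_def sum.distrib[symmetric] p_def q_def
    by (intro sum_mono mean_weight_supermodular)
  hence L: "exp (L n) * exp (L m) \<le> exp (L p) * exp (L q)"
    by (simp flip: exp_add)
  have Z_nonneg: "Z J \<ge> 0" for J
    by (auto simp: Z_def ising_sum_def gibbs_weight_def intro!: sum_nonneg prod_nonneg)
  have nonneg: "0 \<le> K n e" for n e
    by (simp add: K_def coupling_nonneg)
  have below: "K q e \<le> K n e" "K q e \<le> K m e" for e
    unfolding K_def q_def by (intro coupling_mono; simp)+
  \<comment> \<open>Starting from the couplings at the meet \<open>q\<close>, the two nonnegative
    increments together reach \<open>K n + K m - K q\<close>, which supermodularity of the coupling
    bounds by \<open>K p\<close>.\<close>
  have "Z (K n) * Z (K m) = Z (\<lambda>e. K q e + (K n e - K q e)) * Z (\<lambda>e. K q e + (K m e - K q e))"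
    by simp
  also have "\<dots> \<le> Z (\<lambda>e. K q e + (K n e - K q e) + (K m e - K q e)) * Z (K q)"
    unfolding Z_def by (rule ising_sum_supermodular) (use assms nonneg below in auto)
  also have "\<dots> \<le> Z (K p) * Z (K q)"
    unfolding Z_def
  proof (intro mult_right_mono ising_sum_mono)
    fix e
    show "0 \<le> K q e + (K n e - K q e) + (K m e - K q e)"
      using nonneg[of n e] below[of e] by simp
    have "K n e + K m e \<le> K p e + K q e"
      unfolding K_def p_def q_def by (rule coupling_supermodular)
    thus "K q e + (K n e - K q e) + (K m e - K q e) \<le> K p e"
      by simp
  qed (use assms Z_nonneg[unfolded Z_def] in auto)
  finally have "(exp (L n) * exp (L m)) * (Z (K n) * Z (K m)) \<le> (exp (L p) * exp (L q)) * (Z (K p) * Z (K q))"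
    using mult_mono[OF L] by (simp add: Z_nonneg)
  thus ?thesis
    by (simp add: weight p_def q_def mult_ac)
qed

theorem absolute_value_fkg:
  fixes \<psi> \<phi> :: "('a \<Rightarrow> nat) \<Rightarrow> ennreal" and d :: "'e \<Rightarrow> 'a \<times> 'a"
  assumes "finite S" "finite E"
    and \<psi>: "mono_on (PiE_dflt S 0 (\<lambda>_. UNIV)) \<psi>" and \<phi>: "mono_on (PiE_dflt S 0 (\<lambda>_. UNIV)) \<phi>"
  defines "\<mu> \<equiv> density (count_space (PiE_dflt S 0 (\<lambda>_. UNIV))) (\<lambda>h. ennreal (field_weight g E d h))"
  shows "(\<integral>\<^sup>+h. \<psi> (\<lambda>u. nat \<bar>h u\<bar>) \<partial>\<mu>) * (\<integral>\<^sup>+h. \<phi> (\<lambda>u. nat \<bar>h u\<bar>) \<partial>\<mu>)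
       \<le> (\<integral>\<^sup>+h. \<psi> (\<lambda>u. nat \<bar>h u\<bar>) * \<phi> (\<lambda>u. nat \<bar>h u\<bar>) \<partial>\<mu>) * (\<integral>\<^sup>+h. 1 \<partial>\<mu>)"
proof -
  define X where "X = (PiE_dflt S 0 (\<lambda>_. UNIV) :: ('a \<Rightarrow> nat) set)"
  define z where "z n = (\<Prod>u\<in>S. zero_factor (n u))" for n
  define w where "w n = z n * ennreal (abs_weight g S E d n)" for n
  have fold: "(\<integral>\<^sup>+h. F (\<lambda>u. nat \<bar>h u\<bar>) \<partial>\<mu>) = (\<integral>\<^sup>+n. w n * F n \<partial>count_space X)"
    for F :: "('a \<Rightarrow> nat) \<Rightarrow> ennreal"
  proof -
    have inner: "(\<integral>\<^sup>+\<sigma>. ennreal (field_weight g E d (\<lambda>u. \<sigma> u * int (n u))) *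
        F (\<lambda>u. nat \<bar>\<sigma> u * int (n u)\<bar>) \<partial>count_space (signs S)) = ennreal (abs_weight g S E d n) * F n" for n
    proof -
      have "nat \<bar>\<sigma> u * int (n u)\<bar> = n u" if "\<sigma> \<in> signs S" for \<sigma> u
        using signs_cases[OF that, of u] by auto
      hence "(\<integral>\<^sup>+\<sigma>. ennreal (field_weight g E d (\<lambda>u. \<sigma> u * int (n u))) *
          F (\<lambda>u. nat \<bar>\<sigma> u * int (n u)\<bar>) \<partial>count_space (signs S)) =
          (\<Sum>\<sigma>\<in>signs S. ennreal (field_weight g E d (\<lambda>u. \<sigma> u * int (n u))) * F n)"
        by (simp add: nn_integral_count_space_finite finite_signs \<open>finite S\<close>)
      also have "\<dots> = ennreal (abs_weight g S E d n) * F n"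
        unfolding abs_weight_def sum_distrib_right[symmetric]
        by (subst sum_ennreal) (auto simp: field_weight_def intro!: prod_nonneg)
      finally show ?thesis .
    qed
    have "(\<integral>\<^sup>+h. F (\<lambda>u. nat \<bar>h u\<bar>) \<partial>\<mu>) = (\<integral>\<^sup>+h. ennreal (field_weight g E d h) * F (\<lambda>u. nat \<bar>h u\<bar>)
        \<partial>count_space (PiE_dflt S 0 (\<lambda>_. UNIV)))"
      unfolding \<mu>_def by (rule nn_integral_density) auto
    also have "\<dots> = (\<integral>\<^sup>+n. w n * F n \<partial>count_space X)"
      unfolding nn_integral_int_field_fold[OF \<open>finite S\<close>] inner
      by (simp add: X_def w_def z_def mult.assoc)
    finally show ?thesis .
  qed
  \<comment> \<open>At each site, maximum and minimum only permute the two values, so this factor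
    satisfies the lattice condition with equality.\<close>
  have z: "z n * z m = z (\<lambda>u. max (n u) (m u)) * z (\<lambda>u. min (n u) (m u))" for n m
    unfolding z_def prod.distrib[symmetric]
    by (intro prod.cong) (auto simp: max_def min_def mult.commute)
  have w: "w n * w m \<le> w (\<lambda>u. max (n u) (m u)) * w (\<lambda>u. min (n u) (m u))" for n m
  proof -
    have nonneg: "abs_weight g S E d n \<ge> 0" for n
      by (auto simp: abs_weight_def field_weight_def intro!: sum_nonneg prod_nonneg)
    have "(z n * z m) * ennreal (abs_weight g S E d n * abs_weight g S E d m)
      \<le> (z (\<lambda>u. max (n u) (m u)) * z (\<lambda>u. min (n u) (m u))) *
        ennreal (abs_weight g S E d (\<lambda>u. max (n u) (m u)) * abs_weight g S E d (\<lambda>u. min (n u) (m u)))"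
      unfolding z[of n m] by (intro mult_left_mono ennreal_leI abs_weight_supermodular assms) auto
    thus ?thesis
      by (simp add: w_def ennreal_mult nonneg mult_ac)
  qed
  have "(\<integral>\<^sup>+n. w n * \<psi> n \<partial>count_space X) * (\<integral>\<^sup>+n. w n * \<phi> n \<partial>count_space X)
      \<le> (\<integral>\<^sup>+n. w n * (\<psi> n * \<phi> n) \<partial>count_space X) * (\<integral>\<^sup>+n. w n * 1 \<partial>count_space X)"
    unfolding X_def
  \<comment> \<open>Both increasing functions are evaluated at the join, and the constant 1 is
    placed at the meet.\<close>
  proof (rule four_functions[OF \<open>finite S\<close>])
    fix n m :: "'a \<Rightarrow> nat"
    assume nm: "n \<in> PiE_dflt S 0 (\<lambda>_. UNIV)" "m \<in> PiE_dflt S 0 (\<lambda>_. UNIV)"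
    define p where "p = (\<lambda>u. max (n u) (m u))"
    have p: "p \<in> PiE_dflt S 0 (\<lambda>_. UNIV)" "n \<le> p" "m \<le> p"
      using nm by (auto simp: p_def PiE_dflt_def le_fun_def)
    have "(w n * w m) * (\<psi> n * \<phi> m) \<le> (w p * w (\<lambda>u. min (n u) (m u))) * (\<psi> p * \<phi> p)"
      using mult_mono[OF w[of n m] mult_mono[OF mono_onD[OF \<psi> nm(1) p(1,2)] mono_onD[OF \<phi> nm(2) p(1,3)]]]
      unfolding p_def by simp
    thus "w n * \<psi> n * (w m * \<phi> m) \<le> w (\<lambda>u. max (n u) (m u)) *
        (\<psi> (\<lambda>u. max (n u) (m u)) * \<phi> (\<lambda>u. max (n u) (m u))) * (w (\<lambda>u. min (n u) (m u)) * 1)"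
      by (simp add: p_def mult_ac)
  qed
  thus ?thesis
    unfolding fold[of "\<lambda>_. 1"] fold[of "\<lambda>n. \<psi> n * \<phi> n"] fold .
qed

end


section \<open>The height function on a plane graph\<close>

lemma decreasing_curvature_ln_bessel_I:
  "x > 0 \<Longrightarrow> decreasing_curvature (\<lambda>k. ln (bessel_I (nat \<bar>k\<bar>) x))"
  by unfold_locales
    (simp_all add: curvature_ln_bessel_I_nonneg curvature_ln_bessel_I_antimono)

text \<open>The pinned value equals the default value 0, so pinning the outer face amounts to
  removing it from the index set.\<close>

lemma heights_eq: "heights G = PiE_dflt (faces G - {outer_face G}) 0 (\<lambda>_. UNIV)"
  by (auto simp: heights_def PiE_dflt_def)

lemma height_weight_eq:
  assumes "\<beta> > 0"
  shows "height_weight G \<beta> h = field_weight (\<lambda>k. ln (bessel_I (nat \<bar>k\<bar>) \<beta>)) (edges G) (dual_edge G) h"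
  unfolding height_weight_def field_weight_def using bessel_I_pos[OF assms]
  by (intro prod.cong) (auto split: prod.split)

text \<open>A face that lies on no dual edge can be raised freely, which makes the partition function
  infinite. So a finite partition function leaves finitely many faces to consider, without any
  appeal to the topology of the drawing.\<close>

lemma finite_faces:
  assumes "finite (edges G)" "\<beta> > 0" "partition_function G \<beta> < \<infinity>"
  shows "finite (faces G - {outer_face G})"
proof (rule finite_subset)
  show "finite (\<Union>e\<in>edges G. {fst (dual_edge G e), snd (dual_edge G e)})"
    using assms(1) by auto
  show "faces G - {outer_face G} \<subseteq> (\<Union>e\<in>edges G. {fst (dual_edge G e), snd (dual_edge G e)})"
  proof (rule subsetI, rule ccontr)
    fix u assume u: "u \<in> faces G - {outer_face G}"
      and "u \<notin> (\<Union>e\<in>edges G. {fst (dual_edge G e), snd (dual_edge G e)})"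
    hence off: "u \<noteq> fst (dual_edge G e) \<and> u \<noteq> snd (dual_edge G e)" if "e \<in> edges G" for e
      using that by auto
    define raise where "raise k = (\<lambda>_. 0)(u := k)" for k :: int
    define c where "c = (\<Prod>e\<in>edges G. bessel_I 0 \<beta>)"
    have c: "c > 0"
      using assms(2) by (auto simp: c_def bessel_I_pos intro!: prod_pos)
    have weight: "height_weight G \<beta> (raise k) = c" for k
      unfolding height_weight_def c_def
      by (intro prod.cong) (auto simp: raise_def split: prod.split dest: off)
    have sub: "range raise \<subseteq> heights G"
      using u by (auto simp: heights_def PiE_dflt_def raise_def)
    have "inj raise"
      by (auto simp: inj_def raise_def dest: fun_cong[of _ _ u])
    hence "infinite (range raise)"
      by (simp add: finite_image_iff)
    hence "(\<infinity> :: ennreal) = (\<integral>\<^sup>+h. ennreal c \<partial>count_space (range raise))"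
      using c by (simp add: emeasure_count_space_infinite ennreal_mult_top)
    also have "\<dots> = (\<integral>\<^sup>+h. ennreal (height_weight G \<beta> h) \<partial>count_space (range raise))"
      by (intro nn_integral_cong) (auto simp: weight)
    also have "\<dots> = (\<integral>\<^sup>+h. ennreal (height_weight G \<beta> h) * indicator (range raise) h \<partial>count_space UNIV)"
      by (rule nn_integral_count_space_indicator) simp
    also have "\<dots> \<le> (\<integral>\<^sup>+h. ennreal (height_weight G \<beta> h) * indicator (heights G) h \<partial>count_space UNIV)"
      by (intro nn_integral_mono mult_left_mono) (use sub in \<open>auto simp: indicator_def\<close>)
    also have "\<dots> = partition_function G \<beta>"
      unfolding partition_function_def by (rule nn_integral_count_space_indicator[symmetric]) simp
    finally show False
      using assms(3) by simp
  qed
qed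

theorem proposition4:
  fixes G :: "('v, 'e) embedded_graph" and \<beta> :: real
    and \<Psi> \<Phi> :: "(complex set \<Rightarrow> nat) \<Rightarrow> real"
  assumes "plane_graph G" and "\<beta> > 0"
    and "mono_on (abs_heights G) \<Psi>" and "\<And>n. n \<in> abs_heights G \<Longrightarrow> \<Psi> n \<ge> 0"
    and "mono_on (abs_heights G) \<Phi>" and "\<And>n. n \<in> abs_heights G \<Longrightarrow> \<Phi> n \<ge> 0"
  shows "(\<integral>\<^sup>+ h. ennreal (\<Psi> (abs_height h) * \<Phi> (abs_height h)) \<partial>height_law G \<beta>)
       \<ge> (\<integral>\<^sup>+ h. ennreal (\<Psi> (abs_height h)) \<partial>height_law G \<beta>)
         * (\<integral>\<^sup>+ h. ennreal (\<Phi> (abs_height h)) \<partial>height_law G \<beta>)"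
proof -
  define Z where "Z = partition_function G \<beta>"
  define S where "S = faces G - {outer_face G}"
  interpret decreasing_curvature "\<lambda>k. ln (bessel_I (nat \<bar>k\<bar>) \<beta>)"
    by (rule decreasing_curvature_ln_bessel_I) fact
  define \<mu> where "\<mu> = density (count_space (heights G)) (\<lambda>h. ennreal (height_weight G \<beta> h))"
  have mu: "\<mu> = density (count_space (PiE_dflt S 0 (\<lambda>_. UNIV)))
      (\<lambda>h. ennreal (field_weight (\<lambda>k. ln (bessel_I (nat \<bar>k\<bar>) \<beta>)) (edges G) (dual_edge G) h))"
    unfolding \<mu>_def heights_eq S_def height_weight_eq[OF \<open>\<beta> > 0\<close>] ..
  have law: "(\<integral>\<^sup>+h. F h \<partial>height_law G \<beta>) = (\<integral>\<^sup>+h. F h \<partial>\<mu>) / Z" for F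
    unfolding height_law_def \<mu>_def Z_def
    by (simp add: nn_integral_density divide_ennreal_def flip: nn_integral_multc) (simp add: mult_ac)
  have Z: "(\<integral>\<^sup>+h. 1 \<partial>\<mu>) = Z"
    unfolding \<mu>_def Z_def partition_function_def by (subst nn_integral_density) auto
  show ?thesis
  \<comment> \<open>In \<open>ennreal\<close> every quotient by \<infinity> is 0, so in the infinite
    case the inequality reads 0 \<le> 0.\<close>
  proof (cases "Z = \<infinity>")
    case True
    thus ?thesis by (simp add: law)
  next
    case False
    have "finite (edges G)"
      using assms(1) by (simp add: plane_graph_def)
    moreover have "finite S"
      unfolding S_def using False assms(2) \<open>finite (edges G)\<close>
      by (intro finite_faces[of G \<beta>]) (auto simp: Z_def less_top)
    moreover have S_sub: "n \<in> abs_heights G" if "n \<in> PiE_dflt S 0 (\<lambda>_. UNIV)" for n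
      using that by (auto simp: S_def abs_heights_def PiE_dflt_def)
    have "mono_on (PiE_dflt S 0 (\<lambda>_. UNIV)) (\<lambda>n. ennreal (\<Psi> n))"
      "mono_on (PiE_dflt S 0 (\<lambda>_. UNIV)) (\<lambda>n. ennreal (\<Phi> n))"
      by (auto intro!: mono_onI ennreal_leI mono_onD[OF assms(3)] mono_onD[OF assms(5)] S_sub)
    ultimately have fkg: "(\<integral>\<^sup>+h. ennreal (\<Psi> (abs_height h)) \<partial>\<mu>) * (\<integral>\<^sup>+h. ennreal (\<Phi> (abs_height h)) \<partial>\<mu>)
       \<le> (\<integral>\<^sup>+h. ennreal (\<Psi> (abs_height h)) * ennreal (\<Phi> (abs_height h)) \<partial>\<mu>) * Z"
      unfolding Z[symmetric] unfolding mu abs_height_def by (intro absolute_value_fkg)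
    have prod: "(\<integral>\<^sup>+h. ennreal (\<Psi> (abs_height h)) * ennreal (\<Phi> (abs_height h)) \<partial>\<mu>) =
        (\<integral>\<^sup>+h. ennreal (\<Psi> (abs_height h) * \<Phi> (abs_height h)) \<partial>\<mu>)"
    proof (rule nn_integral_cong)
      fix h assume "h \<in> space \<mu>"
      hence "abs_height h \<in> abs_heights G"
        by (auto simp: \<mu>_def heights_def abs_heights_def abs_height_def PiE_dflt_def)
      thus "ennreal (\<Psi> (abs_height h)) * ennreal (\<Phi> (abs_height h)) =
          ennreal (\<Psi> (abs_height h) * \<Phi> (abs_height h))"
        using assms(4,6) by (simp add: ennreal_mult)
    qed
    \<comment> \<open>The zero configuration makes Z positive. After \<open>fkg\<close> is divided
      by Z twice, the factor Z on its right-hand side can then be cancelled.\<close>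
    have "height_weight G \<beta> (\<lambda>_. 0) > 0"
      using assms(2) by (auto simp: height_weight_def bessel_I_pos intro!: prod_pos split: prod.split)
    moreover have "(\<lambda>_. 0) \<in> heights G"
      by (auto simp: heights_def PiE_dflt_def)
    ultimately have "Z \<noteq> 0"
      by (force simp: Z_def partition_function_def nn_integral_0_iff_AE AE_count_space)
    with False have cancel: "a * Z / Z / Z = a / Z" for a
      by (simp add: ennreal_mult_divide_eq)
    have "(a / Z) * (b / Z) = a * b / Z / Z" for a b
      by (simp add: divide_ennreal_def mult_ac)
    thus ?thesis
      unfolding law using divide_right_mono_ennreal[OF divide_right_mono_ennreal[OF fkg[unfolded prod], of Z], of Z]
      by (simp only: cancel)
  qed
qed

end
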